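(* There is an absolute constant $C>0$ such that for every convex set $A\subset\mathbb{R}$, $T_3(A)\leq C|A|^{5/3}$.
   Context: A convex set is a finite set $A=\{a_1<\cdots<a_n\}\subset\mathbb{R}$ whose consecutive differences $a_{i+1}-a_i$ form a strictly increasing sequence. $T_3(A)=|\{(a,b,c)\in A^3: 2a=b+c\}|$. *)

theory Defs
  imports Complex_Main
begin

(* Not to be confused with the constant convex of HOL-Analysis. Indices of the increasing
   enumeration start at 0. *)
definition convex_set :: "real set \<Rightarrow> bool" where
  "convex_set A \<longleftrightarrow> finite A \<and>
     strict_mono_on {..<card A - 1}
       (\<lambda>i. sorted_list_of_set A ! Suc i - sorted_list_of_set A ! i)"

definition T3 :: "real set \<Rightarrow> nat" where
  "T3 A = card {(a, b, c). a \<in> A \<and> b \<in> A \<and> c \<in> A \<and> 2 * a = b + c}"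

end

theory Submission
  imports Defs
begin

text \<open>
  Index \<open>A\<close> increasingly as \<open>a\<^sub>0 < \<dots> < a\<^sub>n\<^sub>-\<^sub>1\<close> and fix a scale \<open>M\<close>. The representations
  \<open>a\<^sub>i + a\<^sub>j = x\<close> of a given \<open>x\<close> form a decreasing staircase in the index grid, which meets
  at most \<open>2n/M + 1\<close> of the \<open>M \<times> M\<close> cells. Two representations \<open>(i', j')\<close> and \<open>(i, j)\<close> in
  one cell, \<open>i' < i\<close>, satisfy \<open>a\<^sub>i - a\<^sub>i\<^sub>' = a\<^sub>j\<^sub>' - a\<^sub>j\<close>, where by convexity \<open>j\<close> is determined by
  \<open>j' - j\<close> and the value of the difference; hence the pair is determined by \<open>i\<close> and the two
  index gaps, both less than \<open>M\<close>, whatever \<open>x\<close> is. So the number of representations of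
  elements of a set \<open>X\<close> is at most \<open>|X|(2n/M + 1) + nM\<^sup>2\<close>. Take \<open>X = 2A\<close> and
  \<open>M\<close> about \<open>n\<^sup>1\<^sup>/\<^sup>3\<close>.
\<close>

text \<open>Each side telescopes into \<open>v\<close> consecutive gaps, which are compared term by
  term. This makes \<open>j\<close> recoverable from \<open>v\<close> and
  \<open>a (j + v) - a j\<close>.\<close>

lemma gap_strict_mono:
  fixes a :: "nat \<Rightarrow> real"
  assumes conv: "strict_mono_on {..<n - 1} (\<lambda>i. a (Suc i) - a i)"
    and "j < j'" "j' + v < n" "0 < v"
  shows "a (j + v) - a j < a (j' + v) - a j'"
proof -
  have gap: "a (m + v) - a m = (\<Sum>k<v. a (Suc (m + k)) - a (m + k))" for m
    using sum_lessThan_telescope[of "\<lambda>k. a (m + k)" v] by simp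
  show ?thesis
    unfolding gap using assms(2-4)
    by (intro sum_strict_mono strict_mono_onD[OF conv]) auto
qed

text \<open>On each fibre of \<open>key\<close> the map \<open>f\<close> is injective, so at most
  one element of the fibre has no smaller rival.\<close>

lemma card_le_card_image_plus_nonminimal:
  fixes f :: "'a \<Rightarrow> nat" and key :: "'a \<Rightarrow> 'b"
  assumes "finite P" and inj: "inj_on (\<lambda>p. (key p, f p)) P"
  shows "card P \<le> card (key ` P) + card {p \<in> P. \<exists>q\<in>P. key q = key p \<and> f q < f p}"
    (is "_ \<le> _ + card ?Q")
proof -
  have "inj_on key (P - ?Q)"
    by (rule inj_onI) (use inj in \<open>force simp: inj_on_def neq_iff\<close>)
  then have "card (P - ?Q) \<le> card (key ` P)"
    using \<open>finite P\<close> by (intro card_inj_on_le) auto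
  moreover have "card P = card (P - ?Q) + card ?Q"
    using card_Int_Diff[OF \<open>finite P\<close>, of ?Q] by (simp add: Int_absorb1)
  ultimately show ?thesis by linarith
qed

lemma diff_less_if_div_eq:
  fixes k l M :: nat
  assumes "k div M = l div M" "0 < M"
  shows "l - k < M"
proof -
  have "l = l div M * M + l mod M" "k = l div M * M + k mod M"
    using div_mult_mod_eq[of l M] div_mult_mod_eq[of k M] assms(1) by simp_all
  then show ?thesis using mod_less_divisor[OF \<open>0 < M\<close>, of l] by linarith
qed

lemma card_sums_in_le:
  fixes a :: "nat \<Rightarrow> real"
  assumes mono: "strict_mono_on {..<n} a"
    and conv: "strict_mono_on {..<n - 1} (\<lambda>i. a (Suc i) - a i)"
    and "finite X" "0 < M"
  shows "card {(i, j). i < n \<and> j < n \<and> a i + a j \<in> X} \<le> card X * (2 * (n div M) + 1) + n * M\<^sup>2"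
proof -
  define P where "P = {(i, j). i < n \<and> j < n \<and> a i + a j \<in> X}"
  \<comment> \<open>Along a staircase the cell is determined by the sum of its two (monotone) coordinates.\<close>
  define key where "key = (\<lambda>(i, j). (a i + a j, i div M + (n - 1 - j) div M))"
  define Q where "Q = {p \<in> P. \<exists>q\<in>P. key q = key p \<and> fst q < fst p}"
  have finP: "finite P"
    by (rule finite_subset[of _ "{..<n} \<times> {..<n}"]) (auto simp: P_def)
  have a_less: "a i < a j \<longleftrightarrow> i < j" if "i < n" "j < n" for i j
    using strict_mono_on_less[OF mono] that by simp
  have a_eq: "a i = a j \<longleftrightarrow> i = j" if "i < n" "j < n" for i j
    using strict_mono_on_eq[OF mono] that by simp
  have "card (key ` P) \<le> card (X \<times> {..2 * (n div M)})"
  proof (rule card_mono)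
    have "i div M + (n - 1 - j) div M \<le> 2 * (n div M)" if "i < n" for i j
      using div_le_mono[of i n M] div_le_mono[of "n - 1 - j" n M] that by linarith
    then show "key ` P \<subseteq> X \<times> {..2 * (n div M)}" by (auto simp: key_def P_def)
  qed (use \<open>finite X\<close> in simp)
  then have keys: "card (key ` P) \<le> card X * (2 * (n div M) + 1)"
    by (simp add: card_cartesian_product)
  have "\<exists>u v. 0 < v \<and> u < M \<and> v < M \<and> j + v < n \<and> a i - a (i - u) = a (j + v) - a j"
    if "(i, j) \<in> Q" for i j
  proof -
    from that obtain i' j' where ij: "i < n" "j < n" "i' < n" "j' < n" "i' < i"
      and x: "a i' + a j' = a i + a j"
      and k: "i' div M + (n - 1 - j') div M = i div M + (n - 1 - j) div M"
      by (auto simp: Q_def P_def key_def)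
    have "a i' < a i" using a_less ij by simp
    then have "j < j'" using x a_less[of j j'] ij by linarith
    \<comment> \<open>Both coordinates are monotone along the staircase, so equal sums force each
      coordinate to agree.\<close>
    have "i' div M \<le> i div M" "(n - 1 - j') div M \<le> (n - 1 - j) div M"
      using \<open>i' < i\<close> \<open>j < j'\<close> by (auto intro: div_le_mono)
    then have "i' div M = i div M" "(n - 1 - j') div M = (n - 1 - j) div M" using k by linarith+
    then have "i - i' < M" "(n - 1 - j) - (n - 1 - j') < M"
      using diff_less_if_div_eq \<open>0 < M\<close> by blast+
    then show ?thesis using ij \<open>j < j'\<close> x
      by (intro exI[of _ "i - i'"] exI[of _ "j' - j"]) auto
  qed
  then obtain u v where uv: "0 < v i j" "u i j < M" "v i j < M" "j + v i j < n"
      "a i - a (i - u i j) = a (j + v i j) - a j"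
    if "(i, j) \<in> Q" for i j
    by metis
  have "card Q \<le> card ({..<n} \<times> {..<M} \<times> {..<M})"
  proof (rule card_inj_on_le)
    show "inj_on (\<lambda>(i, j). (i, u i j, v i j)) Q"
    proof -
      \<comment> \<open>Fixing \<open>i\<close>, \<open>u\<close> and \<open>v\<close> fixes
        \<open>a i - a (i - u)\<close>, hence \<open>a (j + v) - a j\<close>, hence
        \<open>j\<close>. The represented sum does not enter, so this bound carries no factor
        \<open>card X\<close>.\<close>
      have "j = j'"
        if *: "(i, j) \<in> Q" "(i, j') \<in> Q" "u i j = u i j'" "v i j = v i j'" for i j j'
      proof -
        have "a (j + v i j) - a j = a (j' + v i j) - a j'"
          using uv(5)[OF *(1)] uv(5)[OF *(2)] * by simp
        then show ?thesis
          using gap_strict_mono[OF conv, of j j' "v i j"] gap_strict_mono[OF conv, of j' j "v i j"]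
            uv(1,4)[OF *(1)] uv(4)[OF *(2)] * by (cases j j' rule: linorder_cases) auto
      qed
      then show ?thesis by (auto simp: inj_on_def)
    qed
    show "(\<lambda>(i, j). (i, u i j, v i j)) ` Q \<subseteq> {..<n} \<times> {..<M} \<times> {..<M}"
    proof -
      have "i < n" if "(i, j) \<in> Q" for i j
        using that by (simp add: Q_def P_def)
      then show ?thesis using uv(2,3) by auto
    qed
  qed simp
  then have "card Q \<le> n * M\<^sup>2" by (simp add: card_cartesian_product power2_eq_square)
  moreover have "card P \<le> card (key ` P) + card Q"
    unfolding Q_def
    by (rule card_le_card_image_plus_nonminimal[OF finP])
      (auto simp: inj_on_def key_def P_def a_eq)
  ultimately show ?thesis using keys unfolding P_def by linarith
qed

lemma T3_le:
  assumes "convex_set A" "0 < M"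
  shows "T3 A \<le> card A * (2 * (card A div M) + 1) + card A * M\<^sup>2"
proof -
  define n where "n = card A"
  define a where "a = (!) (sorted_list_of_set A)"
  have "finite A" and conv: "strict_mono_on {..<n - 1} (\<lambda>i. a (Suc i) - a i)"
    using assms(1) by (simp_all add: convex_set_def n_def a_def)
  have mono: "strict_mono_on {..<n} a"
    unfolding a_def n_def
    by (rule strict_mono_onI)
      (simp add: sorted_wrt_nth_less[OF strict_sorted_list_of_set])
  have A: "\<exists>i<n. a i = x" if "x \<in> A" for x
    using that \<open>finite A\<close> unfolding a_def n_def
    by (metis in_set_conv_nth length_sorted_list_of_set set_sorted_list_of_set)
  let ?S = "{(i, j). i < n \<and> j < n \<and> a i + a j \<in> (*) 2 ` A}"
  have "finite ?S" by (rule finite_subset[of _ "{..<n} \<times> {..<n}"]) auto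
  moreover have "{(x, b, c). x \<in> A \<and> b \<in> A \<and> c \<in> A \<and> 2 * x = b + c}
      \<subseteq> (\<lambda>(i, j). ((a i + a j) / 2, a i, a j)) ` ?S"
  proof clarify
    fix x b c assume *: "x \<in> A" "b \<in> A" "c \<in> A" "2 * x = b + c"
    then obtain i j where "i < n" "a i = b" "j < n" "a j = c" using A by blast
    with * show "(x, b, c) \<in> (\<lambda>(i, j). ((a i + a j) / 2, a i, a j)) ` ?S"
      by (intro image_eqI[of _ _ "(i, j)"]) (auto intro!: image_eqI[of _ _ x])
  qed
  ultimately have "T3 A \<le> card ?S" unfolding T3_def by (rule surj_card_le)
  also have "\<dots> \<le> card ((*) 2 ` A) * (2 * (n div M) + 1) + n * M\<^sup>2"
    using card_sums_in_le[OF mono conv _ \<open>0 < M\<close>] \<open>finite A\<close> by blast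
  also have "card ((*) 2 ` A) = n"
    unfolding n_def by (rule card_image) (simp add: inj_on_def)
  finally show ?thesis by (simp add: n_def)
qed

theorem theorem1p3:
  shows "\<exists>C::real. C > 0 \<and>
    (\<forall>A::real set. convex_set A \<longrightarrow> real (T3 A) \<le> C * real (card A) powr (5/3))"
proof (intro exI[of _ 7] conjI allI impI)
  fix A :: "real set"
  assume A: "convex_set A"
  define n where "n = card A"
  show "real (T3 A) \<le> 7 * real (card A) powr (5/3)"
  proof (cases "n = 0")
    case True
    \<comment> \<open>Here \<open>0 powr (5/3) = 0\<close>, so the count itself must vanish.\<close>
    then show ?thesis using T3_le[OF A, of 1] by (simp add: n_def)
  next
    case False
    define r where "r = real n powr (1/3)"
    have r1: "1 \<le> r" using False unfolding r_def by (intro ge_one_powr_ge_zero) auto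
    have r3: "real n = r ^ 3" and r5: "real n powr (5/3) = r ^ 5"
      using False by (simp_all add: r_def powr_powr flip: powr_realpow)
    \<comment> \<open>This size balances n^2/M against n M^2; rounding up costs at most a factor 2
      because \<open>1 \<le> r\<close>.\<close>
    define M where "M = nat \<lceil>r\<rceil>"
    have M: "r \<le> real M" "real M \<le> 2 * r" "0 < M"
      using r1 unfolding M_def by linarith+
    have "real (n div M) \<le> real n / real M" by (rule of_nat_div_le_of_nat)
    also have "\<dots> \<le> real n / r" using M r1 by (intro divide_left_mono) auto
    also have "\<dots> = r\<^sup>2" using r1 by (simp add: r3 power3_eq_cube power2_eq_square)
    finally have div: "real (n div M) \<le> r\<^sup>2" .
    have M2: "(real M)\<^sup>2 \<le> 4 * r\<^sup>2"
      using power_mono[OF M(2), of 2] by (simp add: power_mult_distrib)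
    have "real (T3 A) \<le> real (n * (2 * (n div M) + 1) + n * M\<^sup>2)"
      using T3_le[OF A M(3)] unfolding n_def by (rule of_nat_mono)
    also have "\<dots> = real n * (2 * real (n div M) + 1 + (real M)\<^sup>2)"
      by (simp add: algebra_simps)
    \<comment> \<open>7 = 2 + 1 + 4, one summand for each term in the bracket.\<close>
    also have "\<dots> \<le> real n * (7 * r\<^sup>2)"
      using div M2 one_le_power[OF r1, of 2] by (intro mult_left_mono) linarith+
    also have "\<dots> = 7 * r ^ 5" unfolding r3 by (simp flip: power_add)
    finally show ?thesis using r5 by (simp add: n_def)
  qed
qed simp

end
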